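(* Let $X$ be a finite connected poset with $|X|>2$. The following statements are equivalent: (a) Any two edges in $E(\Gamma(X))$ are contained in one cycle. (b) $X$ is $2$-connected. (c) $\Gamma(X)\setminus\{z\}$ is connected for every $z\in X$. (d) $\Gamma(X)$ has no cut vertex.
   Context: The comparability graph $\Gamma(X)$ of a finite poset $X$ is the simple undirected graph with vertex set $X$ in which distinct $x,y$ are adjacent (written $x\sim y$) iff $x<y$ or $y<x$; $E(\Gamma(X))$ is its edge set. $X$ is connected if $\Gamma(X)$ is connected. For a graph $G$ and $S\subseteq V(G)$, $G\setminus S$ is obtained from $G$ by deleting all vertices in $S$ and all edges incident with them. A cycle in $\Gamma(X)$ consists of distinct vertices $x_1,\dots,x_n$, $n\ge3$, with $x_1\sim x_2$, ..., $x_{n-1}\sim x_n$, $x_n\sim x_1$; it contains the edges $\{x_{i-1},x_i\}$ (indices modulo $n$). A vertex $z\in X$ is a cut vertex if $\Gamma(X)\setminus\{z\}$ is disconnected. A finite graph $G$ is $k$-connected ($k\ge1$) if $|V(G)|>k$ and $G\setminus S$ is connected for every $S\subseteq V(G)$ with $|S|<k$; a finite poset $X$ is $k$-connected if $\Gamma(X)$ is $k$-connected. *)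

theory Defs
  imports "Graph_Theory.Digraph_Component"
begin

text \<open>
  An undirected graph is a symmetric digraph, as in the theories of \<open>Graph_Theory\<close>: the edge
  joining \<open>x\<close> and \<open>y\<close> is represented by the two arcs \<open>(x, y)\<close> and \<open>(y, x)\<close>. A poset is a carrier
  \<open>X\<close> with its (reflexive) order relation \<open>r\<close>, \<^term>\<open>partial_order_on X r\<close>, so \<open>x < y\<close> reads
  \<^term>\<open>(x, y) \<in> r - Id\<close>.
\<close>

definition comparability_graph :: "'a set \<Rightarrow> 'a rel \<Rightarrow> ('a, 'a \<times> 'a) pre_digraph" where
  "comparability_graph X r = with_proj
    \<lparr> pverts = X,
      parcs = {(x, y). x \<in> X \<and> y \<in> X \<and> ((x, y) \<in> r - Id \<or> (y, x) \<in> r - Id)} \<rparr>"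

definition edge_set :: "('a, 'b) pre_digraph \<Rightarrow> 'a set set" where
  "edge_set G = {{x, y} | x y. x \<rightarrow>\<^bsub>G\<^esub> y}"

definition delete_verts :: "('a, 'b) pre_digraph \<Rightarrow> 'a set \<Rightarrow> ('a, 'b) pre_digraph" where
  "delete_verts G S = G \<restriction> (verts G - S)"

text \<open>
  The library's \<open>pre_digraph.cycle\<close> cannot be used: it admits the closed walk \<open>x, y, x\<close> along
  the two arcs of a single edge.
\<close>

definition graph_cycle :: "('a, 'b) pre_digraph \<Rightarrow> 'a list \<Rightarrow> bool" where
  "graph_cycle G xs \<longleftrightarrow> 3 \<le> length xs \<and> distinct xs \<and> set xs \<subseteq> verts G \<and>
    (\<forall>i < length xs. xs ! i \<rightarrow>\<^bsub>G\<^esub> xs ! (Suc i mod length xs))"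

definition cycle_edges :: "'a list \<Rightarrow> 'a set set" where
  "cycle_edges xs = {{xs ! i, xs ! (Suc i mod length xs)} | i. i < length xs}"

definition cut_vertex :: "('a, 'b) pre_digraph \<Rightarrow> 'a \<Rightarrow> bool" where
  "cut_vertex G z \<longleftrightarrow> z \<in> verts G \<and> \<not> connected (delete_verts G {z})"

text \<open>
  Only \<open>k \<ge> 1\<close> is meaningful. Finiteness of the graph is implied by \<open>k < card (verts G)\<close>,
  since infinite sets have cardinality \<open>0\<close>.
\<close>

definition k_connected :: "nat \<Rightarrow> ('a, 'b) pre_digraph \<Rightarrow> bool" where
  "k_connected k G \<longleftrightarrow> k < card (verts G) \<and>
    (\<forall>S \<subseteq> verts G. card S < k \<longrightarrow> connected (delete_verts G S))"

definition poset_connected :: "'a set \<Rightarrow> 'a rel \<Rightarrow> bool" where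
  "poset_connected X r \<longleftrightarrow> connected (comparability_graph X r)"

definition poset_k_connected :: "nat \<Rightarrow> 'a set \<Rightarrow> 'a rel \<Rightarrow> bool" where
  "poset_k_connected k X r \<longleftrightarrow> k_connected k (comparability_graph X r)"

text \<open>The comparability graph of a finite poset is a finite simple graph in the library's sense.\<close>

lemma graph_comparability_graph:
  assumes "finite X"
  shows "graph (comparability_graph X r)"
proof -
  have "finite {(x, y). x \<in> X \<and> y \<in> X \<and> ((x, y) \<in> r - Id \<or> (y, x) \<in> r - Id)}"
    by (rule finite_subset[of _ "X \<times> X"]) (use assms in auto)
  then show ?thesis
    using assms unfolding comparability_graph_def
    by unfold_locales (auto simp: symmetric_def sym_def arc_to_ends_def)
qed

end

theory Submission
  imports Defs
begin

text \<open>
  For distinct vertices \<open>a\<close> and \<open>b\<close>, call a pair \<open>(u, v)\<close> linked if there are disjoint paths from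
  \<open>{a, b}\<close> to \<open>{u, v}\<close>. If no vertex deletion disconnects the graph, then a linked pair stays linked
  when one of its two vertices is moved along an edge without hitting the other one. As the graph
  minus one vertex is connected, moving one vertex at a time leads from \<open>(a, b)\<close> to every pair of
  distinct vertices. For edges \<open>ab\<close> and \<open>uv\<close> the two disjoint paths close up to a cycle through
  both. Conversely, if any two edges lie on a cycle, then any two neighbours of \<open>z\<close> are joined by a
  path avoiding \<open>z\<close>, and by connectedness every vertex reaches a neighbour of \<open>z\<close> avoiding \<open>z\<close>.
\<close>

section \<open>Vertex deletion, connectivity and paths\<close>

lemma verts_delete_verts [simp]: "verts (delete_verts G S) = verts G - S"
  by (simp add: delete_verts_def)

lemma dominates_delete_verts:
  "u \<rightarrow>\<^bsub>delete_verts G S\<^esub> v \<longleftrightarrow> u \<rightarrow>\<^bsub>G\<^esub> v \<and> u \<in> verts G - S \<and> v \<in> verts G - S"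
  by (auto simp: delete_verts_def arcs_ends_def arc_to_ends_def)

lemma (in sym_digraph) sym_digraph_delete_verts: "sym_digraph (delete_verts G S)"
  unfolding delete_verts_def by (rule induced_graph_imp_graph) auto

lemma (in sym_digraph) connected_iff_strongly_connected:
  "connected G \<longleftrightarrow> strongly_connected G"
  by (simp add: connected_def strongly_connected_def reachable_mk_symmetric_eq[OF sym_arcs])

text \<open>The predicate \<open>connected\<close> excludes the empty graph, hence the nonemptiness
  conjunct.\<close>

lemma (in sym_digraph) connected_delete_verts_iff:
  "connected (delete_verts G S) \<longleftrightarrow> verts G - S \<noteq> {} \<and>
    (\<forall>u \<in> verts G - S. \<forall>v \<in> verts G - S. u \<rightarrow>\<^sup>*\<^bsub>delete_verts G S\<^esub> v)"
  using sym_digraph.connected_iff_strongly_connected[OF sym_digraph_delete_verts]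
  by (simp add: strongly_connected_def)

lemma (in wf_digraph) hd_reachable:
  assumes "successively (dominates G) xs" "set xs \<subseteq> verts G" "x \<in> set xs"
  shows "hd xs \<rightarrow>\<^sup>* x"
  using assms
proof (induction xs)
  case (Cons y ys)
  then show ?case
    by (cases "ys = []") (auto simp: successively_Cons intro: adj_reachable_trans)
qed simp

text \<open>A walk from \<open>x\<close> is cut at its first vertex in \<open>S\<close> and freed of
  loops. It is listed from \<open>S\<close> back to \<open>x\<close>, so that it can continue an
  initial segment of another path that meets \<open>S\<close> there.\<close>

lemma (in sym_digraph) first_hit_path:
  assumes "x \<rightarrow>\<^sup>* y" "y \<in> S"
  shows "\<exists>xs. xs \<noteq> [] \<and> successively (dominates G) xs \<and> distinct xs \<and> set xs \<subseteq> verts G \<and>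
    hd xs \<in> S \<and> last xs = x \<and> set (tl xs) \<inter> S = {}"
  using assms(1)
proof (induction rule: converse_reachable_induct)
  case base
  then show ?case using assms(2) by (intro exI[of _ "[y]"]) auto
next
  case (step x z)
  then obtain xs where xs: "xs \<noteq> []" "successively (dominates G) xs" "distinct xs"
    "set xs \<subseteq> verts G" "hd xs \<in> S" "last xs = z" "set (tl xs) \<inter> S = {}" by blast
  have zx: "z \<rightarrow> x" "x \<in> verts G"
    using step sym_arcs by (auto simp: symmetric_def elim: symE)
  show ?case
  proof (cases "x \<in> S")
    case True
    then show ?thesis using zx by (intro exI[of _ "[x]"]) auto
  next
    case xS: False
    show ?thesis
    proof (cases "x \<in> set xs")
      \<comment> \<open>Keeping the list only up to the earlier visit of \<open>x\<close> removes
        the loop.\<close>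
      case True
      then obtain ys zs where "xs = ys @ x # zs" by (meson split_list)
      moreover from this have "successively (dominates G) (ys @ [x])"
        using xs(2) by (simp add: successively_append_iff)
      ultimately show ?thesis
        using xs by (intro exI[of _ "ys @ [x]"]) (cases ys; auto)
    next
      case False
      with xs zx xS show ?thesis
        by (intro exI[of _ "xs @ [x]"]) (auto simp: successively_append_iff)
    qed
  qed
qed

section \<open>Linked pairs of vertices\<close>

text \<open>The heads are compared as sets because rerouting can change which of \<open>a\<close>,
  \<open>b\<close> leads to \<open>u\<close>. One-element lists are trivial paths.\<close>

definition linked :: "('a, 'b) pre_digraph \<Rightarrow> 'a \<Rightarrow> 'a \<Rightarrow> 'a \<Rightarrow> 'a \<Rightarrow> bool" where
  "linked G a b u v \<longleftrightarrow> (\<exists>P Q. P \<noteq> [] \<and> Q \<noteq> [] \<and>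
    successively (dominates G) P \<and> successively (dominates G) Q \<and>
    distinct (P @ Q) \<and> set (P @ Q) \<subseteq> verts G \<and>
    {hd P, hd Q} = {a, b} \<and> last P = u \<and> last Q = v)"

lemma linkedI:
  assumes "P \<noteq> []" "Q \<noteq> []" "successively (dominates G) P"
    "successively (dominates G) Q" "distinct (P @ Q)" "set (P @ Q) \<subseteq> verts G"
    "{hd P, hd Q} = {a, b}" "last P = u" "last Q = v"
  shows "linked G a b u v"
  using assms unfolding linked_def by blast

lemma linked_commute:
  assumes "linked G a b u v"
  shows "linked G a b v u"
proof -
  obtain P Q where "P \<noteq> []" "Q \<noteq> []" "successively (dominates G) P"
      "successively (dominates G) Q" "distinct (P @ Q)" "set (P @ Q) \<subseteq> verts G"
      "{hd P, hd Q} = {a, b}" "last P = u" "last Q = v"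
    using assms unfolding linked_def by blast
  then show ?thesis by (intro linkedI[of Q P]) (auto simp: insert_commute)
qed

lemma linked_refl: "a \<in> verts G \<Longrightarrow> b \<in> verts G \<Longrightarrow> a \<noteq> b \<Longrightarrow> linked G a b a b"
  by (rule linkedI[of "[a]" "[b]"]) auto

text \<open>If \<open>w\<close> is on neither path, \<open>Q\<close> is extended; if it is on
  \<open>Q\<close>, \<open>Q\<close> is cut there. If it is on \<open>P\<close>, the part of
  \<open>P\<close> from \<open>w\<close> on is given up, and a path from \<open>u\<close> avoiding
  \<open>w\<close> reconnects \<open>u\<close> to what remains.\<close>

lemma (in sym_digraph) linked_step:
  assumes conn: "connected (delete_verts G {w})"
    and "linked G a b u v" and vw: "v \<rightarrow> w" and "w \<noteq> u"
  shows "linked G a b u w"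
proof -
  obtain P Q where PQ: "P \<noteq> []" "Q \<noteq> []" "successively (dominates G) P"
      "successively (dominates G) Q" "distinct (P @ Q)" "set (P @ Q) \<subseteq> verts G"
      "{hd P, hd Q} = {a, b}" "last P = u" "last Q = v"
    using assms(2) unfolding linked_def by blast
  have w: "w \<in> verts G" using vw by auto
  consider "w \<notin> set (P @ Q)" | "w \<in> set Q" | "w \<in> set P" by auto
  then show ?thesis
  proof cases
    case 1
    then show ?thesis
      using PQ vw w by (intro linkedI[of P "Q @ [w]"]) (auto simp: successively_append_iff)
  next
    case 2
    then obtain ys zs where "Q = ys @ w # zs" by (meson split_list)
    then show ?thesis
      using PQ by (intro linkedI[of P "ys @ [w]"])
        (auto simp: successively_append_iff hd_append split: if_splits)
  next
    case 3
    then obtain ys zs where P: "P = ys @ w # zs" by (meson split_list)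
    interpret H: sym_digraph "delete_verts G {w}" by (rule sym_digraph_delete_verts)
    have "hd Q \<in> set Q" "u \<in> set P" using PQ by auto
    then have "u \<in> verts G - {w}" "hd Q \<in> verts G - {w}"
      using PQ 3 \<open>w \<noteq> u\<close> by auto
    then have "u \<rightarrow>\<^sup>*\<^bsub>delete_verts G {w}\<^esub> hd Q"
      using conn unfolding connected_delete_verts_iff by blast
    \<comment> \<open>\<open>R\<close> leads from its contact with \<open>ys\<close> or
      \<open>Q\<close> to \<open>u\<close>. It may run through \<open>zs\<close>, which is
      discarded.\<close>
    from H.first_hit_path[OF this, of "set ys \<union> set Q"] \<open>hd Q \<in> set Q\<close>
    obtain R where R: "R \<noteq> []" "successively (dominates (delete_verts G {w})) R" "distinct R"
      "set R \<subseteq> verts G - {w}" "hd R \<in> set ys \<union> set Q" "last R = u"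
      "set (tl R) \<inter> (set ys \<union> set Q) = {}" by auto
    have R2: "successively (dominates G) R"
      using R(2) by (rule successively_mono) (simp add: dominates_delete_verts)
    obtain x R' where xR: "R = x # R'" using R(1) by (cases R) auto
    from R(5) xR consider "x \<in> set Q" | "x \<in> set ys" by auto
    then show ?thesis
    proof cases
      case 1
      \<comment> \<open>The ends are exchanged: the front of \<open>P\<close> now stops at
        \<open>w\<close>, and the front of \<open>Q\<close> continues along \<open>R\<close> to
        \<open>u\<close>.\<close>
      then obtain qs qs' where Q: "Q = qs @ x # qs'" by (meson split_list)
      have "linked G a b w u"
        using PQ R R2 xR w unfolding P Q
        by (intro linkedI[of "ys @ [w]" "qs @ R"])
          (auto simp: successively_append_iff hd_append split: if_splits)
      then show ?thesis by (rule linked_commute)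
    next
      case 2
      \<comment> \<open>The front of \<open>P\<close> turns off along \<open>R\<close> to
        \<open>u\<close>, which leaves all of \<open>Q\<close> free to be extended by the edge to
        \<open>w\<close>.\<close>
      then obtain ps ps' where ys: "ys = ps @ x # ps'" by (meson split_list)
      show ?thesis
        using PQ R R2 xR w vw unfolding P ys
        by (intro linkedI[of "ps @ R" "Q @ [w]"])
          (auto simp: successively_append_iff hd_append split: if_splits)
    qed
  qed
qed

text \<open>Deleting \<open>u\<close> keeps the moving vertex away from the fixed one at every step,
  as \<open>linked_step\<close> demands.\<close>

lemma (in sym_digraph) linked_reachable:
  assumes conn: "\<And>z. z \<in> verts G \<Longrightarrow> connected (delete_verts G {z})"
    and "v \<rightarrow>\<^sup>*\<^bsub>delete_verts G {u}\<^esub> w" and "linked G a b u v"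
  shows "linked G a b u w"
proof -
  interpret H: sym_digraph "delete_verts G {u}" by (rule sym_digraph_delete_verts)
  from assms(2) show ?thesis
  proof (induction rule: H.reachable_induct)
    case (step x y)
    then have "x \<rightarrow> y" "y \<in> verts G" "y \<noteq> u" by (auto simp: dominates_delete_verts)
    then show ?case using conn step.IH by (intro linked_step[of y a b u x])
  qed (use assms(3) in simp)
qed

lemma (in sym_digraph) linked_if_connected:
  assumes conn: "\<And>z. z \<in> verts G \<Longrightarrow> connected (delete_verts G {z})"
    and "a \<in> verts G" "b \<in> verts G" "a \<noteq> b" "u \<in> verts G" "v \<in> verts G" "u \<noteq> v"
  shows "linked G a b u v"
proof -
  have move: "linked G a b x z"
    if "linked G a b x y" "x \<in> verts G" "y \<in> verts G" "z \<in> verts G" "y \<noteq> x" "z \<noteq> x" for x y z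
  proof (rule linked_reachable[OF conn _ that(1)])
    show "y \<rightarrow>\<^sup>*\<^bsub>delete_verts G {x}\<^esub> z"
      using conn[of x] that unfolding connected_delete_verts_iff by blast
  qed
  have ba: "linked G a b b a" using assms(2-4) by (rule linked_commute[OF linked_refl])
  \<comment> \<open>The route is from \<open>(b, a)\<close> via \<open>(b, u)\<close>, swapped to
    \<open>(u, b)\<close>, to \<open>(u, v)\<close>. The middle pair degenerates if
    \<open>u = b\<close>; then one move of \<open>a\<close> to \<open>v\<close> suffices.\<close>
  show ?thesis
  proof (cases "u = b")
    case True
    then show ?thesis using move[OF ba, of v] assms(2-7) by blast
  next
    case False
    then have "linked G a b b u" using move[OF ba, of u] assms(2-7) by blast
    then show ?thesis
      using move[of u b v] linked_commute[of G a b b u] False assms(2-7) by blast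
  qed
qed

section \<open>Cycles as lists, and cycles from disjoint paths\<close>

lemma graph_cycle_iff_successively:
  "graph_cycle G xs \<longleftrightarrow> 3 \<le> length xs \<and> distinct xs \<and> set xs \<subseteq> verts G \<and>
    successively (dominates G) xs \<and> last xs \<rightarrow>\<^bsub>G\<^esub> hd xs"
proof -
  have "(\<forall>i < length xs. xs ! i \<rightarrow>\<^bsub>G\<^esub> xs ! (Suc i mod length xs)) \<longleftrightarrow>
      successively (dominates G) xs \<and> last xs \<rightarrow>\<^bsub>G\<^esub> hd xs" (is "?L \<longleftrightarrow> ?R")
    if "3 \<le> length xs"
  proof -
    have ne: "xs \<noteq> []" using that by auto
    obtain n where n: "length xs = Suc n" using ne by (cases xs) auto
    \<comment> \<open>Wrap-around occurs only at the last index \<open>n\<close>, where it yields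
      the closing edge from \<open>last xs\<close> to \<open>hd xs\<close>.\<close>
    have "Suc i mod Suc n = Suc i" if "i < n" for i using that by simp
    then have "?L \<longleftrightarrow> (\<forall>i < n. xs ! i \<rightarrow>\<^bsub>G\<^esub> xs ! Suc i) \<and> xs ! n \<rightarrow>\<^bsub>G\<^esub> xs ! 0"
      by (auto simp: n less_Suc_eq)
    also have "\<dots> \<longleftrightarrow> ?R"
      using ne by (simp add: successively_conv_nth n last_conv_nth hd_conv_nth)
    finally show ?thesis .
  qed
  then show ?thesis unfolding graph_cycle_def by blast
qed

lemma cycle_edges_last_hd: "xs \<noteq> [] \<Longrightarrow> {last xs, hd xs} \<in> cycle_edges xs"
  unfolding cycle_edges_def
  by (auto intro!: exI[of _ "length xs - 1"] simp: last_conv_nth hd_conv_nth)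

text \<open>The edge at the seam of two paths laid end to end. Together with the closing edge it
  supplies the two prescribed edges of the cycle.\<close>

lemma cycle_edges_append:
  assumes "ys \<noteq> []" "zs \<noteq> []"
  shows "{last ys, hd zs} \<in> cycle_edges (ys @ zs)"
proof -
  have "Suc (length ys - 1) mod length (ys @ zs) = length ys" using assms by (cases ys; cases zs) auto
  then show ?thesis
    using assms unfolding cycle_edges_def
    by (auto intro!: exI[of _ "length ys - 1"] simp: last_conv_nth hd_conv_nth nth_append)
qed

lemma cycle_edges_subset:
  assumes "e \<in> cycle_edges xs"
  shows "e \<subseteq> set xs"
proof -
  from assms obtain i where i: "i < length xs" "e = {xs ! i, xs ! (Suc i mod length xs)}"
    unfolding cycle_edges_def by auto
  then have "Suc i mod length xs < length xs" by (intro mod_less_divisor) linarith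
  with i show ?thesis by simp
qed

lemma (in sym_digraph) cycle_through_edges:
  assumes conn: "\<And>z. z \<in> verts G \<Longrightarrow> connected (delete_verts G {z})"
    and ab: "a \<rightarrow> b" "a \<noteq> b" and uv: "u \<rightarrow> v" "u \<noteq> v" and ne: "{a, b} \<noteq> {u, v}"
  shows "\<exists>xs. graph_cycle G xs \<and> {a, b} \<in> cycle_edges xs \<and> {u, v} \<in> cycle_edges xs"
proof -
  have sym: "x \<rightarrow> y \<Longrightarrow> y \<rightarrow> x" for x y
    using sym_arcs by (auto simp: symmetric_def elim: symE)
  have "linked G a b u v" using conn ab uv by (intro linked_if_connected) auto
  then obtain P Q where PQ: "P \<noteq> []" "Q \<noteq> []" "successively (dominates G) P"
      "successively (dominates G) Q" "distinct (P @ Q)" "set (P @ Q) \<subseteq> verts G"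
      "{hd P, hd Q} = {a, b}" "last P = u" "last Q = v"
    unfolding linked_def by blast
  \<comment> \<open>The cycle runs from \<open>u\<close> back along \<open>P\<close>, across the
    edge between \<open>a\<close> and \<open>b\<close>, along \<open>Q\<close> to \<open>v\<close>,
    and closes with the edge from \<open>v\<close> to \<open>u\<close>.\<close>
  let ?xs = "rev P @ Q"
  have "hd P \<rightarrow> hd Q" using PQ(7) ab(1) sym by (auto simp: doubleton_eq_iff)
  moreover have "successively (dominates G) (rev P)"
    using PQ(3) sym by (auto elim: successively_mono)
  \<comment> \<open>Were both paths trivial, \<open>{a, b}\<close> and \<open>{u, v}\<close> would
    coincide, against \<open>ne\<close>.\<close>
  moreover have "3 \<le> length ?xs"
  proof (rule ccontr)
    assume "\<not> ?thesis"
    moreover have "0 < length P" "0 < length Q" using PQ(1,2) by auto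
    ultimately have "length P = 1" "length Q = 1" unfolding length_append length_rev by linarith+
    then have "hd P = last P" "hd Q = last Q" by (auto simp: length_Suc_conv)
    with PQ ne show False by simp
  qed
  ultimately have "graph_cycle G ?xs"
    using PQ uv(1) sym unfolding graph_cycle_iff_successively
    by (auto simp: successively_append_iff last_rev hd_rev)
  moreover have "{a, b} \<in> cycle_edges ?xs"
    using cycle_edges_append[of "rev P" Q] PQ by (simp add: last_rev)
  moreover have "{u, v} \<in> cycle_edges ?xs"
    using cycle_edges_last_hd[of ?xs] PQ by (simp add: hd_rev insert_commute)
  ultimately show ?thesis by blast
qed

text \<open>Removing \<open>z\<close> from a cycle leaves a path through all its other
  vertices.\<close>

lemma (in sym_digraph) cycle_reachable_delete_vert:
  assumes "graph_cycle G xs" "z \<in> set xs" "c \<in> set xs - {z}" "d \<in> set xs - {z}"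
  shows "c \<rightarrow>\<^sup>*\<^bsub>delete_verts G {z}\<^esub> d"
proof -
  interpret H: sym_digraph "delete_verts G {z}" by (rule sym_digraph_delete_verts)
  obtain ys zs where xs: "xs = ys @ z # zs" using assms(2) by (meson split_list)
  \<comment> \<open>The cycle rotated to begin just after \<open>z\<close>; if both parts are
    nonempty, the old closing edge joins \<open>zs\<close> to \<open>ys\<close>.\<close>
  let ?L = "zs @ ys"
  have "successively (dominates G) ?L"
    using assms(1) unfolding graph_cycle_iff_successively xs
    by (cases "ys = []"; cases "zs = []") (auto simp: successively_append_iff successively_Cons)
  moreover have sub: "set ?L \<subseteq> verts G - {z}"
    using assms(1) unfolding graph_cycle_def xs by auto
  ultimately have "successively (dominates (delete_verts G {z})) ?L"
    by (elim successively_mono) (auto simp: dominates_delete_verts)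
  then have "hd ?L \<rightarrow>\<^sup>*\<^bsub>delete_verts G {z}\<^esub> x" if "x \<in> set ?L" for x
    using H.hd_reachable that sub by simp
  moreover have "c \<in> set ?L" "d \<in> set ?L" using assms(3,4) xs by auto
  ultimately show ?thesis
    by (metis H.reachable_trans H.symmetric_reachable')
qed

text \<open>The walk to \<open>z\<close> is stopped just before it first enters
  \<open>z\<close>.\<close>

lemma (in sym_digraph) reachable_neighbour_delete_vert:
  assumes "x \<rightarrow>\<^sup>* z" "x \<noteq> z"
  shows "\<exists>c. c \<rightarrow> z \<and> c \<noteq> z \<and> x \<rightarrow>\<^sup>*\<^bsub>delete_verts G {z}\<^esub> c"
  using assms
proof (induction rule: converse_reachable_induct)
  case (step x y)
  interpret H: sym_digraph "delete_verts G {z}" by (rule sym_digraph_delete_verts)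
  have x: "x \<in> verts (delete_verts G {z})" using step by auto
  show ?case
  proof (cases "y = z")
    case True
    then show ?thesis using step x by (auto intro!: exI[of _ x])
  next
    case False
    then have "x \<rightarrow>\<^bsub>delete_verts G {z}\<^esub> y" using step by (auto simp: dominates_delete_verts)
    then show ?thesis using step False H.adj_reachable_trans by blast
  qed
qed simp

text \<open>Both \<open>x\<close> and \<open>y\<close> first travel to neighbours \<open>c\<close>
  and \<open>d\<close> of \<open>z\<close>; a cycle through the edges \<open>{c, z}\<close> and
  \<open>{d, z}\<close> then joins \<open>c\<close> to \<open>d\<close> outside
  \<open>z\<close>.\<close>

lemma (in sym_digraph) connected_delete_vert_if_cycles:
  assumes conn: "connected G" and "z \<in> verts G" "verts G \<noteq> {z}"
    and cyc: "\<And>e f. e \<in> edge_set G \<Longrightarrow> f \<in> edge_set G \<Longrightarrow> e \<noteq> f \<Longrightarrow>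
      \<exists>xs. graph_cycle G xs \<and> e \<in> cycle_edges xs \<and> f \<in> cycle_edges xs"
  shows "connected (delete_verts G {z})"
  unfolding connected_delete_verts_iff
proof (intro conjI ballI)
  interpret H: sym_digraph "delete_verts G {z}" by (rule sym_digraph_delete_verts)
  show "verts G - {z} \<noteq> {}" using assms by auto
  fix x y assume xy: "x \<in> verts G - {z}" "y \<in> verts G - {z}"
  have "\<exists>c. c \<rightarrow> z \<and> c \<noteq> z \<and> x \<rightarrow>\<^sup>*\<^bsub>delete_verts G {z}\<^esub> c" if "x \<in> verts G - {z}" for x
    using conn that \<open>z \<in> verts G\<close> reachable_neighbour_delete_vert
    unfolding connected_iff_strongly_connected strongly_connected_def by auto
  with xy obtain c d where c: "c \<rightarrow> z" "c \<noteq> z" "x \<rightarrow>\<^sup>*\<^bsub>delete_verts G {z}\<^esub> c"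
    and d: "d \<rightarrow> z" "d \<noteq> z" "y \<rightarrow>\<^sup>*\<^bsub>delete_verts G {z}\<^esub> d" by meson
  have "c \<rightarrow>\<^sup>*\<^bsub>delete_verts G {z}\<^esub> d"
  proof (cases "c = d")
    case True
    then show ?thesis using c by auto
  next
    case False
    have "{c, z} \<in> edge_set G" "{d, z} \<in> edge_set G" "{c, z} \<noteq> {d, z}"
      using c d False unfolding edge_set_def by (auto simp: doubleton_eq_iff)
    then obtain xs where "graph_cycle G xs" "{c, z} \<in> cycle_edges xs" "{d, z} \<in> cycle_edges xs"
      using cyc by blast
    then show ?thesis
      using cycle_edges_subset[of "{c, z}" xs] cycle_edges_subset[of "{d, z}" xs] c d
      by (intro cycle_reachable_delete_vert[of xs]) auto
  qed
  then show "x \<rightarrow>\<^sup>*\<^bsub>delete_verts G {z}\<^esub> y"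
    using c d by (metis H.reachable_trans H.symmetric_reachable')
qed

section \<open>The equivalences\<close>

lemma (in graph) all_cycles_iff_connected_delete_vert:
  assumes "connected G" "card (verts G) > 1"
  shows "(\<forall>e \<in> edge_set G. \<forall>f \<in> edge_set G. e \<noteq> f \<longrightarrow>
      (\<exists>xs. graph_cycle G xs \<and> e \<in> cycle_edges xs \<and> f \<in> cycle_edges xs))
    \<longleftrightarrow> (\<forall>z \<in> verts G. connected (delete_verts G {z}))" (is "?L \<longleftrightarrow> ?R")
proof
  assume ?L
  then show ?R using assms connected_delete_vert_if_cycles by fastforce
next
  assume R: ?R
  show ?L
  proof (intro ballI impI)
    fix e f assume ef: "e \<in> edge_set G" "f \<in> edge_set G" "e \<noteq> f"
    then obtain a b u v where "e = {a, b}" "a \<rightarrow> b" "f = {u, v}" "u \<rightarrow> v"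
      unfolding edge_set_def by blast
    \<comment> \<open>A \<open>graph\<close> has no loops, which gives the distinct endpoints that
      linking requires.\<close>
    moreover from this have "a \<noteq> b" "u \<noteq> v" using adj_not_same by auto
    ultimately show "\<exists>xs. graph_cycle G xs \<and> e \<in> cycle_edges xs \<and> f \<in> cycle_edges xs"
      using R ef cycle_through_edges by auto
  qed
qed

lemma (in sym_digraph) two_connected_iff:
  assumes "connected G" "card (verts G) > 2"
  shows "k_connected 2 G \<longleftrightarrow> (\<forall>z \<in> verts G. connected (delete_verts G {z}))"
proof
  assume "k_connected 2 G"
  then show "\<forall>z \<in> verts G. connected (delete_verts G {z})"
    unfolding k_connected_def by auto
next
  assume R: "\<forall>z \<in> verts G. connected (delete_verts G {z})"
  have "delete_verts G {} = G"
    using induce_eq_iff_induced[OF induced_subgraph_refl] by (simp add: delete_verts_def)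
  then have "connected (delete_verts G S)" if "S \<subseteq> verts G" "card S < 2" for S
  proof -
    \<comment> \<open>An infinite \<open>S\<close> would also have \<open>card S = 0\<close>; it is
      excluded because a vertex set of positive cardinality is finite.\<close>
    have "finite S" using assms(2) that(1) by (metis card.infinite finite_subset not_less_zero)
    then consider "S = {}" | z where "S = {z}"
      using \<open>card S < 2\<close> by (metis card_0_eq card_1_singletonE less_2_cases_iff One_nat_def)
    then show ?thesis using R that assms \<open>delete_verts G {} = G\<close> by cases auto
  qed
  with assms show "k_connected 2 G" unfolding k_connected_def by blast
qed

theorem lemma2p4:
  fixes X :: "'a set" and r :: "'a rel"
  assumes "finite X"
    and "partial_order_on X r"
    and "poset_connected X r"
    and "card X > 2"
  shows "((\<forall>e \<in> edge_set (comparability_graph X r). \<forall>f \<in> edge_set (comparability_graph X r).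
             e \<noteq> f \<longrightarrow>
             (\<exists>xs. graph_cycle (comparability_graph X r) xs \<and> e \<in> cycle_edges xs \<and> f \<in> cycle_edges xs))
          \<longleftrightarrow> poset_k_connected 2 X r)
       \<and> (poset_k_connected 2 X r
          \<longleftrightarrow> (\<forall>z \<in> X. connected (delete_verts (comparability_graph X r) {z})))
       \<and> ((\<forall>z \<in> X. connected (delete_verts (comparability_graph X r) {z}))
          \<longleftrightarrow> \<not> (\<exists>z. cut_vertex (comparability_graph X r) z))"
proof -
  interpret graph "comparability_graph X r"
    using assms(1) by (rule graph_comparability_graph)
  have verts: "verts (comparability_graph X r) = X" by (simp add: comparability_graph_def)
  have conn: "connected (comparability_graph X r)" using assms(3) by (simp add: poset_connected_def)
  have "poset_k_connected 2 X r
      \<longleftrightarrow> (\<forall>z \<in> X. connected (delete_verts (comparability_graph X r) {z}))"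
    using two_connected_iff[OF conn] assms(4) by (simp add: poset_k_connected_def verts)
  moreover have "(\<forall>z \<in> X. connected (delete_verts (comparability_graph X r) {z}))
      \<longleftrightarrow> \<not> (\<exists>z. cut_vertex (comparability_graph X r) z)"
    by (auto simp: cut_vertex_def verts)
  \<comment> \<open>The cycle condition is compared with single-vertex deletions, so its equivalence
    with 2-connectedness comes by composition.\<close>
  ultimately show ?thesis
    using all_cycles_iff_connected_delete_vert[OF conn] assms(4) by (simp add: verts)
qed

end
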